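(* Let $(N,A,c)$ be a public bads instance, let $x\in\Delta(A)$, write $S=\operatorname{supp}(x)=\{a\in A:x(a)>0\}$ and $N(S)=\{i\in N: c_i(a)>0\text{ for some }a\in S\}$. The following are equivalent. (1) $x$ is proportionally fair. (2) The restriction $x_S=(x(a))_{a\in S}$ satisfies $x_S\in\arg\max_{y\in\Delta(S)}\prod_{i\in N(S)}c_i(y)$, and for all $a\in A\setminus S$, $\frac1n\sum_{i\in N}\frac{c_i(a)}{c_i(x)}\ge1$.
   Context: A public bads instance $(N,A,c)$ consists of agents $N=\{1,\dots,n\}$, a finite set $A$ of alternatives (bads), and cost functions $c_i:A\to\mathbb{R}_{\ge 0}$, $i\in N$. For $S\subseteq A$, $\Delta(S)$ is the set of probability vectors on $S$; $c_i(y)=\sum_{a}y(a)c_i(a)$ and $c(y)=(c_i(y))_{i\in N}$. Standing assumptions: $0\notin\{c(x):x\in\Delta(A)\}$, and for every $i\in N$ there is $a\in A$ with $c_i(a)<\max_{a'\in A}c_i(a')$. Proportional fairness: $x\in\Delta(A)$ is proportionally fair if $\frac1n\sum_{i\in N}\frac{c_i(y)}{c_i(x)}\ge 1$ for all $y\in\Delta(A)$. Throughout, ratios use the conventions $0/0=1$ and $\alpha/0=+\infty$ for $\alpha>0$. *)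

theory Defs
  imports Complex_Main "HOL-Library.FuncSet" "HOL-Library.Extended_Real"
begin

text \<open>Probability vectors on \<open>S\<close> are functions with domain \<open>S\<close>, so the restriction of a vector
  to \<open>S\<close> is literally \<^term>\<open>restrict x S\<close>.\<close>

definition lotteries :: "'a set \<Rightarrow> ('a \<Rightarrow> real) set" where
  "lotteries S = {y \<in> S \<rightarrow>\<^sub>E {0..}. (\<Sum>a\<in>S. y a) = 1}"

text \<open>\<open>c i a\<close> is the cost of alternative \<open>a\<close> to agent \<open>i\<close>; \<open>cost c S i y\<close> is its linear extension
  to \<open>y \<in> lotteries S\<close>. The domain \<open>S\<close> of \<open>y\<close> has to be passed explicitly.\<close>

definition cost :: "(nat \<Rightarrow> 'a \<Rightarrow> real) \<Rightarrow> 'a set \<Rightarrow> nat \<Rightarrow> ('a \<Rightarrow> real) \<Rightarrow> real" where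
  "cost c S i y = (\<Sum>a\<in>S. y a * c i a)"

locale public_bads =
  fixes n :: nat and A :: "'a set" and c :: "nat \<Rightarrow> 'a \<Rightarrow> real"
  assumes finite_bads: "finite A"
    and cost_nonneg: "\<And>i a. i \<in> {1..n} \<Longrightarrow> a \<in> A \<Longrightarrow> 0 \<le> c i a"
    and cost_vector_nonzero: "\<And>y. y \<in> lotteries A \<Longrightarrow> \<exists>i\<in>{1..n}. cost c A i y \<noteq> 0"
    and not_indifferent: "\<And>i. i \<in> {1..n} \<Longrightarrow> \<exists>a\<in>A. c i a < Max (c i ` A)"

text \<open>Division in \<^typ>\<open>ereal\<close> has \<open>0 / 0 = 0\<close>, whereas here \<open>0 / 0 = 1\<close>. The arguments are
  always nonnegative.\<close>

definition ratio :: "real \<Rightarrow> real \<Rightarrow> ereal" where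
  "ratio r s = (if s = 0 then (if r = 0 then 1 else \<infinity>) else ereal (r / s))"

definition proportionally_fair ::
  "nat \<Rightarrow> 'a set \<Rightarrow> (nat \<Rightarrow> 'a \<Rightarrow> real) \<Rightarrow> ('a \<Rightarrow> real) \<Rightarrow> bool" where
  "proportionally_fair n A c x \<longleftrightarrow> x \<in> lotteries A \<and>
     (\<forall>y\<in>lotteries A. ereal (1 / real n) * (\<Sum>i=1..n. ratio (cost c A i y) (cost c A i x)) \<ge> 1)"

definition supp :: "'a set \<Rightarrow> ('a \<Rightarrow> real) \<Rightarrow> 'a set" where
  "supp A x = {a \<in> A. x a > 0}"

definition agents_of :: "nat \<Rightarrow> (nat \<Rightarrow> 'a \<Rightarrow> real) \<Rightarrow> 'a set \<Rightarrow> nat set" where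
  "agents_of n c S = {i \<in> {1..n}. \<exists>a\<in>S. c i a > 0}"

end

theory Submission
  imports Defs
begin

text \<open>Proportional fairness is linear in the deviation, so it suffices to test pure alternatives \<open>a\<close>.
  Agents outside \<open>N(S)\<close> contribute 1 or \<open>\<infinity>\<close>, so if all contributions are finite the condition
  reads \<open>g(a) \<ge> |N(S)|\<close> with \<open>g(a) = (\<Sum>i\<in>N(S). c\<^sub>i(a) / c\<^sub>i(x))\<close>. As \<open>x\<close> is positive on \<open>S\<close> and the
  \<open>x\<close>-average of \<open>g\<close> equals \<open>|N(S)|\<close>, a one-sided inequality on all of \<open>S\<close>, in either direction,
  forces \<open>g = |N(S)|\<close> there. Optimality of \<open>x\<close> for the product gives \<open>g \<le> |N(S)|\<close> on \<open>S\<close> as first-order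
  condition; conversely \<open>g = |N(S)|\<close> on \<open>S\<close> implies optimality by AM-GM.\<close>

lemma lotteries_nonneg: "y \<in> lotteries S \<Longrightarrow> a \<in> S \<Longrightarrow> 0 \<le> y a"
  by (auto simp: lotteries_def PiE_def Pi_def)

lemma lotteries_sum: "y \<in> lotteries S \<Longrightarrow> (\<Sum>a\<in>S. y a) = 1"
  by (simp add: lotteries_def)

lemma lotteriesI:
  "(\<And>a. a \<in> S \<Longrightarrow> 0 \<le> y a) \<Longrightarrow> (\<Sum>a\<in>S. y a) = 1 \<Longrightarrow> restrict y S \<in> lotteries S"
  by (auto simp: lotteries_def cong: sum.cong)

lemma cost_restrict [simp]: "cost c S i (restrict y S) = cost c S i y"
  by (simp add: cost_def cong: sum.cong)

lemma cost_of_bool: "finite S \<Longrightarrow> a \<in> S \<Longrightarrow> cost c S i (\<lambda>b. of_bool (b = a)) = c i a"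
  by (simp add: cost_def of_bool_def if_distrib [of "\<lambda>u. u * _"] cong: if_cong)

lemma point_lottery:
  "finite S \<Longrightarrow> a \<in> S \<Longrightarrow> restrict (\<lambda>b. of_bool (b = a)) S \<in> lotteries S"
  by (rule lotteriesI) (auto simp: of_bool_def)

lemma lottery_cost_nonneg:
  "(\<And>a. a \<in> S \<Longrightarrow> 0 \<le> c i a) \<Longrightarrow> y \<in> lotteries S \<Longrightarrow> 0 \<le> cost c S i y"
  unfolding cost_def by (intro sum_nonneg mult_nonneg_nonneg) (auto intro: lotteries_nonneg)

text \<open>Exchanging the two sums turns the total ratio of a lottery into the
  \<open>y\<close>-average of the total ratios of pure alternatives. All averaging arguments below
  rest on this.\<close>

lemma sum_cost_divide:
  "(\<Sum>i\<in>M. cost c S i y / d i) = (\<Sum>a\<in>S. y a * (\<Sum>i\<in>M. c i a / d i))"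
  unfolding cost_def sum_divide_distrib sum_distrib_left by (subst sum.swap) simp

text \<open>The terms \<open>z a * (g a - k)\<close> share one sign and sum to zero, so each
  vanishes; the positive weights then cancel.\<close>

lemma lottery_average_eqI:
  fixes k :: real
  assumes "finite S" "z \<in> lotteries S" "\<And>a. a \<in> S \<Longrightarrow> 0 < z a"
    and avg: "(\<Sum>a\<in>S. z a * g a) = k"
    and dir: "(\<forall>a\<in>S. k \<le> g a) \<or> (\<forall>a\<in>S. g a \<le> k)"
    and "a \<in> S"
  shows "g a = k"
proof -
  have zero: "(\<Sum>a\<in>S. z a * (g a - k)) = 0"
    using avg lotteries_sum [OF assms(2)]
    by (simp add: algebra_simps sum_subtractf flip: sum_distrib_left)
  from dir have "\<forall>a\<in>S. z a * (g a - k) = 0"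
  proof
    assume "\<forall>a\<in>S. k \<le> g a"
    then have "\<And>a. a \<in> S \<Longrightarrow> 0 \<le> z a * (g a - k)"
      using assms(3) by (simp add: less_imp_le)
    then show ?thesis
      using zero assms(1) by (simp add: sum_nonneg_eq_0_iff)
  next
    assume "\<forall>a\<in>S. g a \<le> k"
    then have "\<And>a. a \<in> S \<Longrightarrow> 0 \<le> z a * (k - g a)"
      using assms(3) by (simp add: less_imp_le)
    moreover have "(\<Sum>a\<in>S. z a * (k - g a)) = 0"
      using zero by (simp add: right_diff_distrib sum_subtractf)
    ultimately show ?thesis
      using assms(1) by (auto simp: sum_nonneg_eq_0_iff)
  qed
  then show ?thesis using assms(3) [OF \<open>a \<in> S\<close>] \<open>a \<in> S\<close> by auto
qed

text \<open>AM-GM in normalized form: multiplying the bounds \<open>r i \<le> exp (r i - 1)\<close>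
  moves the hypothesis on the sum into the exponent.\<close>

lemma prod_le_one_if_sum_le_card:
  fixes r :: "'b \<Rightarrow> real"
  assumes "finite M" "\<And>i. i \<in> M \<Longrightarrow> 0 \<le> r i" "(\<Sum>i\<in>M. r i) \<le> card M"
  shows "(\<Prod>i\<in>M. r i) \<le> 1"
proof -
  have "(\<Prod>i\<in>M. r i) \<le> (\<Prod>i\<in>M. exp (r i - 1))"
    using assms(2) exp_ge_add_one_self by (intro prod_mono) (smt (verit))
  also have "\<dots> = exp (\<Sum>i\<in>M. r i - 1)"
    using assms(1) by (simp add: exp_sum)
  also have "\<dots> \<le> 1"
    using assms(3) by (simp add: sum_subtractf)
  finally show ?thesis .
qed

text \<open>The sum is the derivative at \<open>t = 0\<close> of the product, whose value there is
  1. Were it positive, the product would exceed 1 for small \<open>t > 0\<close>.\<close>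

lemma sum_nonpos_if_prod_le_one:
  fixes u :: "'b \<Rightarrow> real"
  assumes "finite M" and le: "\<And>t. 0 < t \<Longrightarrow> t < 1 \<Longrightarrow> (\<Prod>i\<in>M. 1 + t * u i) \<le> 1"
  shows "(\<Sum>i\<in>M. u i) \<le> 0"
proof (rule ccontr)
  assume "\<not> ?thesis"
  then have pos: "0 < (\<Sum>i\<in>M. u i)" by simp
  have "((\<lambda>t. \<Prod>i\<in>M. 1 + t * u i) has_field_derivative
      (\<Sum>i\<in>M. u i * (\<Prod>j\<in>M - {i}. 1 + 0 * u j))) (at 0)"
    by (intro has_field_derivative_prod) (auto intro!: derivative_eq_intros)
  then have "((\<lambda>t. \<Prod>i\<in>M. 1 + t * u i) has_field_derivative (\<Sum>i\<in>M. u i)) (at 0)"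
    by simp
  from DERIV_pos_inc_right [OF this pos] obtain d where d: "d > 0"
      "\<And>h. 0 < h \<Longrightarrow> h < d \<Longrightarrow> (\<Prod>i\<in>M. 1 + 0 * u i) < (\<Prod>i\<in>M. 1 + (0 + h) * u i)"
    by blast
  \<comment> \<open>This \<open>t\<close> lies below both \<open>d\<close> and 1, so the strict
    increase and the assumed bound apply to it together.\<close>
  then have "1 < (\<Prod>i\<in>M. 1 + min (d/2) (1/2) * u i)"
    using d(2) [of "min (d/2) (1/2)"] by simp
  then show False
    using le [of "min (d/2) (1/2)"] d(1) by (simp add: min_less_iff_disj)
qed

text \<open>The first-order condition naturally gives \<open>\<le>\<close>; the right-hand side has
  the opposite direction because that is how fairness presents itself. As \<open>z\<close> is
  positive on all of \<open>S\<close>, averaging turns either one into equality.\<close>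

lemma is_arg_max_prod_cost_iff:
  assumes fin: "finite S" "finite M"
    and nonneg: "\<And>i a. i \<in> M \<Longrightarrow> a \<in> S \<Longrightarrow> 0 \<le> c i a"
    and z: "z \<in> lotteries S" "\<And>a. a \<in> S \<Longrightarrow> 0 < z a"
    and pos: "\<And>i. i \<in> M \<Longrightarrow> 0 < cost c S i z"
  shows "is_arg_max (\<lambda>y. \<Prod>i\<in>M. cost c S i y) (\<lambda>y. y \<in> lotteries S) z \<longleftrightarrow>
    (\<forall>a\<in>S. real (card M) \<le> (\<Sum>i\<in>M. c i a / cost c S i z))"
    (is "?L \<longleftrightarrow> ?R")
proof -
  define g where "g a = (\<Sum>i\<in>M. c i a / cost c S i z)" for a
  have avg: "(\<Sum>a\<in>S. z a * g a) = card M"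
    unfolding g_def sum_cost_divide [symmetric] using pos by (simp add: less_imp_neq [symmetric])
  have prod_pos: "0 < (\<Prod>i\<in>M. cost c S i z)"
    using pos by (rule prod_pos)
  \<comment> \<open>Normalizing the optimal value to 1 brings both product inequalities into
    play.\<close>
  have L_iff: "?L \<longleftrightarrow> (\<forall>y\<in>lotteries S. (\<Prod>i\<in>M. cost c S i y / cost c S i z) \<le> 1)"
  proof -
    have "(\<Prod>i\<in>M. cost c S i y) \<le> (\<Prod>i\<in>M. cost c S i z) \<longleftrightarrow>
        (\<Prod>i\<in>M. cost c S i y / cost c S i z) \<le> 1" for y
      using prod_pos by (simp add: prod_dividef)
    then show ?thesis
      using z(1) by (auto simp: is_arg_max_def not_less)
  qed
  show ?thesis
  proof
    assume ?L
    have "g a \<le> card M" if a: "a \<in> S" for a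
    proof -
      have "(\<Sum>i\<in>M. c i a / cost c S i z - 1) \<le> 0"
      proof (rule sum_nonpos_if_prod_le_one [OF fin(2)])
        fix t :: real assume t: "0 < t" "t < 1"
        \<comment> \<open>Shifting a fraction \<open>t\<close> of the mass from \<open>z\<close>
          towards \<open>a\<close> changes each normalized cost to \<open>1 + t * u i\<close> with
          \<open>u i = c i a / cost c S i z - 1\<close>.\<close>
        define y where "y b = (1 - t) * z b + t * of_bool (b = a)" for b
        have "restrict y S \<in> lotteries S"
        proof (rule lotteriesI)
          show "0 \<le> y b" if "b \<in> S" for b
            using t z(2) [OF that] by (simp add: y_def)
          show "(\<Sum>b\<in>S. y b) = 1"
            using fin a lotteries_sum [OF z(1)]
            by (simp add: y_def sum.distrib flip: sum_distrib_left)
        qed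
        then have "(\<Prod>i\<in>M. cost c S i y / cost c S i z) \<le> 1"
          using \<open>?L\<close> unfolding L_iff by fastforce
        moreover have "cost c S i y / cost c S i z = 1 + t * (c i a / cost c S i z - 1)"
          if "i \<in> M" for i
        proof -
          have "cost c S i y = (1 - t) * cost c S i z + t * cost c S i (\<lambda>b. of_bool (b = a))"
            unfolding cost_def y_def sum_distrib_left sum.distrib [symmetric]
            by (intro sum.cong) (simp_all add: algebra_simps)
          then show ?thesis
            using pos [OF that] by (simp add: cost_of_bool [OF fin(1) a] field_simps)
        qed
        ultimately show "(\<Prod>i\<in>M. 1 + t * (c i a / cost c S i z - 1)) \<le> 1"
          by (simp cong: prod.cong)
      qed
      then show ?thesis by (simp add: g_def sum_subtractf)
    qed
    then show ?R
      using lottery_average_eqI [OF fin(1) z avg] by (auto simp: g_def)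
  next
    assume ?R
    then have g: "g a = card M" if "a \<in> S" for a
      using lottery_average_eqI [OF fin(1) z avg _ that] by (simp add: g_def)
    show ?L
      unfolding L_iff
    proof
      fix y assume y: "y \<in> lotteries S"
      have "(\<Sum>i\<in>M. cost c S i y / cost c S i z) = (\<Sum>a\<in>S. y a * card M)"
        unfolding sum_cost_divide using g by (auto simp: g_def)
      also have "\<dots> = card M"
        using lotteries_sum [OF y] by (simp flip: sum_distrib_right)
      finally show "(\<Prod>i\<in>M. cost c S i y / cost c S i z) \<le> 1"
        using fin(2) y nonneg pos
        by (intro prod_le_one_if_sum_le_card divide_nonneg_pos lottery_cost_nonneg) auto
    qed
  qed
qed

text \<open>This removes the conventions for zero denominators: an agent with \<open>s i = 0\<close>
  contributes either \<open>\<infinity>\<close>, which settles the inequality, or exactly 1, which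
  cancels against its share of \<open>n\<close>.\<close>

lemma average_ratio_ge_one_iff:
  assumes "n > 0"
  shows "ereal (1 / real n) * (\<Sum>i=1..n. ratio (f i) (s i)) \<ge> 1 \<longleftrightarrow>
    (\<exists>i\<in>{1..n}. s i = 0 \<and> f i \<noteq> 0) \<or>
    real (card {i\<in>{1..n}. s i \<noteq> 0}) \<le> (\<Sum>i\<in>{i\<in>{1..n}. s i \<noteq> 0}. f i / s i)"
    (is "?L \<longleftrightarrow> ?inf \<or> real (card ?M) \<le> ?sum")
proof (cases ?inf)
  case True
  then have "(\<Sum>i=1..n. ratio (f i) (s i)) = \<infinity>"
    by (subst sum_Pinfty) (auto simp: ratio_def)
  then show ?thesis using True assms by simp
next
  case False
  have "(\<Sum>i=1..n. ratio (f i) (s i)) = (\<Sum>i=1..n. ereal (if s i = 0 then 1 else f i / s i))"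
    using False by (intro sum.cong) (auto simp: ratio_def one_ereal_def)
  also have "\<dots> = ereal (\<Sum>i=1..n. if s i = 0 then 1 else f i / s i)"
    by simp
  also have "(\<Sum>i=1..n. if s i = 0 then 1 else f i / s i) = card {i\<in>{1..n}. s i = 0} + ?sum"
    by (subst sum.If_cases) (auto simp: Int_def)
  finally have "?L \<longleftrightarrow> n \<le> card {i\<in>{1..n}. s i = 0} + ?sum"
    using assms by (simp add: field_simps one_ereal_def)
  moreover have "card {i\<in>{1..n}. s i = 0} + card ?M = n"
    by (subst card_Un_disjoint [symmetric]) (auto intro: arg_cong [of _ "{1..n}" card, simplified])
  ultimately show ?thesis using False by linarith
qed

theorem proposition6p1:
  fixes n :: nat and A :: "'a set" and c :: "nat \<Rightarrow> 'a \<Rightarrow> real"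
    and x :: "'a \<Rightarrow> real" and S :: "'a set"
  assumes "public_bads n A c"
    and "x \<in> lotteries A"
    and "S = supp A x"
  shows "proportionally_fair n A c x \<longleftrightarrow>
    is_arg_max (\<lambda>y. \<Prod>i\<in>agents_of n c S. cost c S i y) (\<lambda>y. y \<in> lotteries S) (restrict x S) \<and>
    (\<forall>a\<in>A - S. ereal (1 / real n) * (\<Sum>i=1..n. ratio (c i a) (cost c A i x)) \<ge> 1)"
proof -
  interpret public_bads n A c by fact
  define M where "M = agents_of n c S"
  define C where "C i = cost c A i x" for i
  \<comment> \<open>A nonzero coordinate of the cost vector of \<open>x\<close> exhibits an
    agent.\<close>
  have n: "n > 0"
    using cost_vector_nonzero [OF assms(2)] by auto
  have S: "S \<subseteq> A" "finite S" and x_pos: "\<And>a. a \<in> S \<Longrightarrow> 0 < x a"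
    using assms(3) finite_bads by (auto simp: supp_def)
  have x_zero: "x a = 0" if "a \<in> A - S" for a
    using that lotteries_nonneg [OF assms(2), of a] assms(3) by (auto simp: supp_def)
  have C_S: "C i = cost c S i x" for i
    unfolding C_def cost_def using S x_zero finite_bads by (intro sum.mono_neutral_right) auto
  have C_nonneg: "0 \<le> C i" if "i \<in> {1..n}" for i
    unfolding C_def using assms(2) cost_nonneg that by (intro lottery_cost_nonneg) auto
  \<comment> \<open>Since \<open>x\<close> is positive throughout \<open>S\<close>, a cost at
    \<open>x\<close> vanishes only if it vanishes on all of \<open>S\<close>. Thus the factors of
    the product belong exactly to the agents with nonzero denominators.\<close>
  have M_iff: "i \<in> M \<longleftrightarrow> i \<in> {1..n} \<and> C i \<noteq> 0" for i
  proof (cases "i \<in> {1..n}")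
    case True
    have "C i = 0 \<longleftrightarrow> (\<forall>a\<in>S. x a * c i a = 0)"
      unfolding C_S cost_def using True S x_pos cost_nonneg
      by (intro sum_nonneg_eq_0_iff mult_nonneg_nonneg) (auto intro: less_imp_le)
    also have "\<dots> \<longleftrightarrow> \<not> (\<exists>a\<in>S. 0 < c i a)"
      using x_pos cost_nonneg [OF True] S(1) by (force simp: less_le)
    finally show ?thesis using True by (auto simp: M_def agents_of_def)
  qed (auto simp: M_def agents_of_def)
  have M_eq: "M = {i\<in>{1..n}. C i \<noteq> 0}"
    using M_iff by blast
  have "finite M" by (simp add: M_eq)
  have C_pos: "0 < C i" if "i \<in> M" for i
    using that C_nonneg by (auto simp: M_iff less_le)
  \<comment> \<open>The first disjunct is the case of an infinite ratio, the second the remaining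
    inequality between reals.\<close>
  define fair where "fair f \<longleftrightarrow> (\<exists>i\<in>{1..n}. C i = 0 \<and> f i \<noteq> 0) \<or> real (card M) \<le> (\<Sum>i\<in>M. f i / C i)"
    for f
  have fair_iff: "ereal (1 / real n) * (\<Sum>i=1..n. ratio (f i) (C i)) \<ge> 1 \<longleftrightarrow> fair f" for f
    unfolding fair_def M_eq by (rule average_ratio_ge_one_iff [OF n])
  have PF: "proportionally_fair n A c x \<longleftrightarrow> (\<forall>a\<in>A. fair (\<lambda>i. c i a))"
  proof -
    have "proportionally_fair n A c x \<longleftrightarrow> (\<forall>y\<in>lotteries A. fair (\<lambda>i. cost c A i y))"
      using assms(2) unfolding proportionally_fair_def C_def [symmetric] fair_iff by blast
    also have "\<dots> \<longleftrightarrow> (\<forall>a\<in>A. fair (\<lambda>i. c i a))"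
    proof (intro iffI ballI)
      fix a assume *: "\<forall>y\<in>lotteries A. fair (\<lambda>i. cost c A i y)" and a: "a \<in> A"
      show "fair (\<lambda>i. c i a)"
        using bspec [OF * point_lottery [OF finite_bads a]] cost_of_bool [OF finite_bads a] by simp
    next
      fix y assume *: "\<forall>a\<in>A. fair (\<lambda>i. c i a)" and y: "y \<in> lotteries A"
      show "fair (\<lambda>i. cost c A i y)"
      proof (cases "\<exists>i\<in>{1..n}. C i = 0 \<and> cost c A i y \<noteq> 0")
        case True
        then show ?thesis by (simp add: fair_def)
      next
        case False
        \<comment> \<open>If \<open>y a > 0\<close>, an agent with zero cost at both
          \<open>x\<close> and \<open>y\<close> has zero cost at \<open>a\<close>. No ratio at
          \<open>a\<close> is then infinite, so fairness at \<open>a\<close> supplies the real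
          inequality, to be averaged with weights \<open>y\<close>.\<close>
        have "y a * card M \<le> y a * (\<Sum>i\<in>M. c i a / C i)" if a: "a \<in> A" for a
        proof (cases "y a = 0")
          case False
          have "c i a = 0" if i: "i \<in> {1..n}" "C i = 0" for i
          proof -
            have "cost c A i y = 0"
              using \<open>\<not> (\<exists>i\<in>{1..n}. C i = 0 \<and> cost c A i y \<noteq> 0)\<close> i by blast
            then have "\<forall>a\<in>A. y a * c i a = 0"
              unfolding cost_def
              by (subst (asm) sum_nonneg_eq_0_iff)
                 (auto intro!: finite_bads mult_nonneg_nonneg lotteries_nonneg [OF y] cost_nonneg i)
            then show ?thesis using a \<open>y a \<noteq> 0\<close> by auto
          qed
          then have "card M \<le> (\<Sum>i\<in>M. c i a / C i)"
            using * a by (auto simp: fair_def)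
          then show ?thesis by (intro mult_left_mono lotteries_nonneg [OF y a])
        qed simp
        then have "(\<Sum>a\<in>A. y a * card M) \<le> (\<Sum>i\<in>M. cost c A i y / C i)"
          unfolding sum_cost_divide by (intro sum_mono)
        then show ?thesis
          using lotteries_sum [OF y] by (simp add: fair_def flip: sum_distrib_right)
      qed
    qed
    finally show ?thesis .
  qed
  \<comment> \<open>Agents with zero cost at \<open>x\<close> have zero cost on the support, so
    infinite ratios cannot occur there.\<close>
  have fair_S: "fair (\<lambda>i. c i a) \<longleftrightarrow> card M \<le> (\<Sum>i\<in>M. c i a / C i)" if "a \<in> S" for a
  proof -
    have "c i a = 0" if "i \<in> {1..n}" "C i = 0" for i
    proof -
      have "i \<notin> agents_of n c S"
        using M_iff that by (simp add: M_def)
      then show ?thesis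
        using that \<open>a \<in> S\<close> S(1) cost_nonneg [of i a] by (force simp: agents_of_def)
    qed
    then show ?thesis by (auto simp: fair_def)
  qed
  have "(\<Sum>a\<in>S. x a) = 1"
    using lotteries_sum [OF assms(2)] sum.mono_neutral_right [OF finite_bads S(1), of x] x_zero
    by simp
  then have "restrict x S \<in> lotteries S"
    using x_pos by (intro lotteriesI less_imp_le)
  then have "is_arg_max (\<lambda>y. \<Prod>i\<in>M. cost c S i y) (\<lambda>y. y \<in> lotteries S) (restrict x S)
      \<longleftrightarrow> (\<forall>a\<in>S. fair (\<lambda>i. c i a))"
    using S \<open>finite M\<close> cost_nonneg x_pos C_pos
    by (subst is_arg_max_prod_cost_iff) (auto simp: M_iff fair_S simp flip: C_S)
  \<comment> \<open>Fairness against all of \<open>A\<close> splits into the points of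
    \<open>S\<close>, which amount to optimality, and those of \<open>A - S\<close>.\<close>
  then show ?thesis
    unfolding PF C_def [symmetric] fair_iff M_def [symmetric] using S(1) by blast
qed

end
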